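(* Let $\mathcal{H}$ be a complex Hilbert space, $A\in\mathcal{B}(\mathcal{H})$ a positive operator, and $T,S\in\mathcal{B}_{A^{1/2}}(\mathcal{H})$. Then, for each choice of sign $\pm$, $$r_A(TS\pm ST)\leq\frac12\left(\|TS\|_A+\|ST\|_A+\sqrt{\left(\|TS\|_A-\|ST\|_A\right)^2+4\|T^2\|_A\|S^2\|_A}\right).$$
   Context: $\mathcal{B}(\mathcal{H})$ is the algebra of bounded linear operators on the complex Hilbert space $(\mathcal{H},\langle\cdot\mid\cdot\rangle)$. For positive $A$, put $\langle x\mid y\rangle_A=\langle Ax\mid y\rangle$ and $\|x\|_A=\langle x\mid x\rangle_A^{1/2}=\|A^{1/2}x\|$. $\mathcal{B}_{A^{1/2}}(\mathcal{H})$ is the set of $T\in\mathcal{B}(\mathcal{H})$ for which there is $\lambda>0$ with $\|Tx\|_A\le\lambda\|x\|_A$ for all $x\in\mathcal{H}$ ($A$-bounded operators). For such $T$, $\|T\|_A=\sup\{\|Tx\|_A: x\in\mathcal{H},\ \|x\|_A=1\}$ (a supremum over the empty set, occurring only if $A=0$, is $0$), and the $A$-spectral radius is $r_A(T)=\inf_{n\ge1}\|T^n\|_A^{1/n}=\lim_{n\to\infty}\|T^n\|_A^{1/n}$. *)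

theory Defs
  imports "HOL-Analysis.Analysis"
begin

text \<open>
  Complex Hilbert spaces, on top of the library's real normed and complete spaces, so that
  \<open>norm\<close>, \<open>bounded_linear\<close> and completeness are the library's own.
  The inner product is linear in its first argument.
\<close>

class complex_inner_space = real_normed_vector +
  fixes scaleC :: "complex \<Rightarrow> 'a \<Rightarrow> 'a" (infixr \<open>*\<^sub>C\<close> 75)
    and cinner :: "'a \<Rightarrow> 'a \<Rightarrow> complex"
  assumes scaleC_add_right: "a *\<^sub>C (x + y) = a *\<^sub>C x + a *\<^sub>C y"
    and scaleC_add_left: "(a + b) *\<^sub>C x = a *\<^sub>C x + b *\<^sub>C x"
    and scaleC_scaleC: "a *\<^sub>C b *\<^sub>C x = (a * b) *\<^sub>C x"
    and scaleC_one: "1 *\<^sub>C x = x"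
    and scaleR_eq_scaleC: "r *\<^sub>R x = complex_of_real r *\<^sub>C x"
    and cinner_add_left: "cinner (x + y) z = cinner x z + cinner y z"
    and cinner_scaleC_left: "cinner (a *\<^sub>C x) y = a * cinner x y"
    and cinner_commute: "cinner x y = cnj (cinner y x)"
    and cinner_ge_zero: "0 \<le> Re (cinner x x)"
    and cinner_eq_zero_iff: "cinner x x = 0 \<longleftrightarrow> x = 0"
    and norm_eq_sqrt_cinner: "norm x = sqrt (Re (cinner x x))"

class complex_hilbert_space = complex_inner_space + complete_space

instantiation complex :: complex_hilbert_space
begin

definition scaleC_complex :: "complex \<Rightarrow> complex \<Rightarrow> complex"
  where "scaleC_complex a x = a * x"

definition cinner_complex :: "complex \<Rightarrow> complex \<Rightarrow> complex"
  where "cinner_complex x y = x * cnj y"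

instance
  by standard
    (auto simp: scaleC_complex_def cinner_complex_def algebra_simps scaleR_conv_of_real
      cmod_def power2_eq_square)

end

definition bounded_clinear ::
    "('a::complex_inner_space \<Rightarrow> 'b::complex_inner_space) \<Rightarrow> bool"
  where "bounded_clinear f \<longleftrightarrow>
    bounded_linear f \<and> (\<forall>c x. f (c *\<^sub>C x) = c *\<^sub>C f x)"

definition positive_op :: "('a::complex_inner_space \<Rightarrow> 'a) \<Rightarrow> bool"
  where "positive_op A \<longleftrightarrow>
    bounded_clinear A \<and> (\<forall>x. cinner (A x) x \<in> \<real> \<and> 0 \<le> Re (cinner (A x) x))"

definition A_cinner :: "('a::complex_inner_space \<Rightarrow> 'a) \<Rightarrow> 'a \<Rightarrow> 'a \<Rightarrow> complex"
  where "A_cinner A x y = cinner (A x) y"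

definition A_norm :: "('a::complex_inner_space \<Rightarrow> 'a) \<Rightarrow> 'a \<Rightarrow> real"
  where "A_norm A x = sqrt (Re (A_cinner A x x))"

definition A_bounded ::
    "('a::complex_inner_space \<Rightarrow> 'a) \<Rightarrow> ('a \<Rightarrow> 'a) \<Rightarrow> bool"
  where "A_bounded A T \<longleftrightarrow>
    bounded_clinear T \<and> (\<exists>c>0. \<forall>x. A_norm A (T x) \<le> c * A_norm A x)"

text \<open>
  The supremum is that of the reals, hence only meaningful on nonempty bounded sets;
  boundedness is guaranteed when \<open>T\<close> is \<open>A\<close>-bounded.
\<close>

definition A_opnorm ::
    "('a::complex_inner_space \<Rightarrow> 'a) \<Rightarrow> ('a \<Rightarrow> 'a) \<Rightarrow> real"
  where "A_opnorm A T =
    (if {x. A_norm A x = 1} = {} then 0 else (SUP x\<in>{x. A_norm A x = 1}. A_norm A (T x)))"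

definition A_spectral_radius ::
    "('a::complex_inner_space \<Rightarrow> 'a) \<Rightarrow> ('a \<Rightarrow> 'a) \<Rightarrow> real"
  where "A_spectral_radius A T = (INF n\<in>{1..}. root n (A_opnorm A (T ^^ n)))"

end

theory Submission
  imports Defs
begin

text \<open>
  Write \<open>P = T S \<plusminus> S T\<close>. Since \<open>S P = (S T) S \<plusminus> S\<^sup>2 T\<close> and \<open>T P = T\<^sup>2 S \<plusminus> (T S) T\<close>, the pair
  \<open>(\<parallel>S P\<^sup>n x\<parallel>\<^sub>A, \<parallel>T P\<^sup>n x\<parallel>\<^sub>A)\<close> is dominated by the iterates of the nonnegative matrix with rows
  \<open>(\<parallel>S T\<parallel>\<^sub>A, \<parallel>S\<^sup>2\<parallel>\<^sub>A)\<close> and \<open>(\<parallel>T\<^sup>2\<parallel>\<^sub>A, \<parallel>T S\<parallel>\<^sub>A)\<close>, whose Perron eigenvalue is the claimed bound.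
  For any \<open>r\<close> above this eigenvalue there are positive weights \<open>u\<close>, \<open>v\<close> such that
  \<open>u \<parallel>S x\<parallel>\<^sub>A + v \<parallel>T x\<parallel>\<^sub>A\<close> grows by at most the factor \<open>r\<close> under \<open>P\<close>; this potential controls
  \<open>\<parallel>P x\<parallel>\<^sub>A\<close> and is controlled by \<open>\<parallel>x\<parallel>\<^sub>A\<close>, so that \<open>\<parallel>P\<^sup>n\<parallel>\<^sub>A\<close> is of order \<open>r\<^sup>n\<close>.
\<close>

section \<open>The seminorm induced by a positive operator\<close>

lemma cinner_add_right:
  "cinner x (y + z) = cinner x y + cinner x (z :: 'a::complex_inner_space)"
  by (metis cinner_add_left cinner_commute complex_cnj_add)

lemma cinner_scaleR_left:
  "cinner (r *\<^sub>R x) (y :: 'a::complex_inner_space) = of_real r * cinner x y"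
  by (simp add: scaleR_eq_scaleC cinner_scaleC_left)

lemma cinner_scaleR_right:
  "cinner x (r *\<^sub>R y :: 'a::complex_inner_space) = of_real r * cinner x y"
  by (metis cinner_scaleR_left cinner_commute complex_cnj_mult complex_cnj_complex_of_real)

lemma positive_op_linear: "positive_op A \<Longrightarrow> linear A"
  by (auto simp: positive_op_def bounded_clinear_def bounded_linear.linear)

lemma A_bounded_linear: "A_bounded A T \<Longrightarrow> linear T"
  by (auto simp: A_bounded_def bounded_clinear_def bounded_linear.linear)

lemma A_norm_nonneg: "positive_op A \<Longrightarrow> 0 \<le> A_norm A x"
  by (simp add: A_norm_def A_cinner_def positive_op_def)

lemma A_norm_power2: "positive_op A \<Longrightarrow> (A_norm A x)\<^sup>2 = Re (cinner (A x) x)"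
  by (simp add: A_norm_def A_cinner_def positive_op_def)

lemma A_norm_scaleR:
  assumes "positive_op A"
  shows "A_norm A (r *\<^sub>R x) = \<bar>r\<bar> * A_norm A x"
proof -
  have "A_norm A (r *\<^sub>R x) = sqrt (r\<^sup>2 * Re (cinner (A x) x))"
    by (simp add: A_norm_def A_cinner_def linear_cmul[OF positive_op_linear[OF assms]]
        cinner_scaleR_left cinner_scaleR_right power2_eq_square mult.assoc)
  then show ?thesis
    by (simp add: A_norm_def A_cinner_def real_sqrt_mult)
qed

text \<open>
  Cauchy--Schwarz for the symmetrised real form, which is all the triangle inequality needs;
  this avoids showing that \<open>A\<close> is self-adjoint.
\<close>

lemma A_norm_Cauchy_Schwarz:
  assumes "positive_op A"
  shows "Re (cinner (A x) y) + Re (cinner (A y) x) \<le> 2 * A_norm A x * A_norm A y"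
proof -
  let ?a = "A_norm A x" and ?b = "A_norm A y"
  let ?c = "Re (cinner (A x) y) + Re (cinner (A y) x)"
  \<comment> \<open>Positivity of \<open>A\<close> at \<open>s x - t y\<close>; the choice
    \<open>s = ?b\<close>, \<open>t = ?a\<close> would give the claim after division by
    \<open>?a * ?b\<close>.\<close>
  have quad: "0 \<le> s\<^sup>2 * ?a\<^sup>2 - s * t * ?c + t\<^sup>2 * ?b\<^sup>2" for s t
  proof -
    have "0 \<le> Re (cinner (A (s *\<^sub>R x + (- t) *\<^sub>R y)) (s *\<^sub>R x + (- t) *\<^sub>R y))"
      using assms by (simp add: positive_op_def)
    also have "\<dots> = s\<^sup>2 * ?a\<^sup>2 - s * t * ?c + t\<^sup>2 * ?b\<^sup>2"
      unfolding A_norm_power2[OF assms] linear_add[OF positive_op_linear[OF assms]]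
        linear_cmul[OF positive_op_linear[OF assms]]
        cinner_add_left cinner_add_right cinner_scaleR_left cinner_scaleR_right
      by (simp add: power2_eq_square algebra_simps)
    finally show ?thesis .
  qed
  \<comment> \<open>Shifting both seminorms by \<open>e\<close> keeps the divisor positive even if
    one of them vanishes; afterwards \<open>e\<close> tends to 0.\<close>
  have lim: "?c \<le> 2 * (?a + e) * (?b + e)" if "e > 0" for e :: real
  proof -
    have pos: "0 < ?a + e" "0 < ?b + e"
      using that A_norm_nonneg[OF assms] by (auto intro: add_nonneg_pos)
    have "(?b + e) * (?a + e) * ?c \<le> (?b + e)\<^sup>2 * ?a\<^sup>2 + (?a + e)\<^sup>2 * ?b\<^sup>2"
      using quad[of "?b + e" "?a + e"] by linarith
    also have "\<dots> \<le> (?b + e)\<^sup>2 * (?a + e)\<^sup>2 + (?a + e)\<^sup>2 * (?b + e)\<^sup>2"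
      using that by (intro add_mono mult_left_mono power_mono)
        (auto simp: A_norm_nonneg[OF assms])
    also have "\<dots> = (?b + e) * (?a + e) * (2 * (?a + e) * (?b + e))"
      by (simp add: power2_eq_square)
    finally show ?thesis
      using pos by (simp add: mult_le_cancel_left_pos)
  qed
  have "((\<lambda>e. 2 * (?a + e) * (?b + e)) \<longlongrightarrow> 2 * (?a + 0) * (?b + 0)) (at_right 0)"
    by (intro tendsto_intros)
  moreover have "\<forall>\<^sub>F e in at_right 0. ?c \<le> 2 * (?a + e) * (?b + e)"
    using lim by (auto simp: eventually_at_right_less intro: eventually_mono[OF eventually_at_right_less])
  ultimately have "?c \<le> 2 * (?a + 0) * (?b + 0)"
    by (rule tendsto_lowerbound) simp
  then show ?thesis by simp
qed

lemma A_norm_triangle: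
  assumes "positive_op A"
  shows "A_norm A (x + y) \<le> A_norm A x + A_norm A y"
proof (rule power2_le_imp_le)
  have "(A_norm A (x + y))\<^sup>2 = (A_norm A x)\<^sup>2 + (A_norm A y)\<^sup>2
      + (Re (cinner (A x) y) + Re (cinner (A y) x))"
    by (simp add: A_norm_power2[OF assms] linear_add[OF positive_op_linear[OF assms]]
        cinner_add_left cinner_add_right)
  also have "\<dots> \<le> (A_norm A x + A_norm A y)\<^sup>2"
    using A_norm_Cauchy_Schwarz[OF assms, of x y] by (simp add: power2_sum)
  finally show "(A_norm A (x + y))\<^sup>2 \<le> (A_norm A x + A_norm A y)\<^sup>2" .
  show "0 \<le> A_norm A x + A_norm A y"
    by (simp add: A_norm_nonneg[OF assms])
qed

section \<open>\<open>A\<close>-bounded operators and their operator seminorm\<close>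

lemma A_bounded_compose:
  assumes "A_bounded A T" "A_bounded A S"
  shows "A_bounded A (T \<circ> S)"
proof -
  obtain c d where c: "c > 0" "\<And>x. A_norm A (T x) \<le> c * A_norm A x"
    and d: "d > 0" "\<And>x. A_norm A (S x) \<le> d * A_norm A x"
    using assms unfolding A_bounded_def by blast
  have "A_norm A (T (S x)) \<le> (c * d) * A_norm A x" for x
    using order_trans[OF c(2)[of "S x"] mult_left_mono[OF d(2)[of x]]] c(1)
    by (simp add: mult.assoc)
  moreover have "c * d > 0" using c d by simp
  moreover have "bounded_clinear (T \<circ> S)"
    using assms bounded_linear_compose[of T S]
    by (auto simp: A_bounded_def bounded_clinear_def comp_def)
  ultimately show ?thesis
    unfolding A_bounded_def comp_def by blast
qed

lemma A_opnorm_upper: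
  assumes "positive_op A" "A_bounded A T" "A_norm A x = 1"
  shows "A_norm A (T x) \<le> A_opnorm A T"
proof -
  obtain c where "\<And>x. A_norm A (T x) \<le> c * A_norm A x"
    using assms(2) unfolding A_bounded_def by blast
  then have "bdd_above ((\<lambda>x. A_norm A (T x)) ` {x. A_norm A x = 1})"
    by (intro bdd_aboveI[of _ c]) (auto, metis mult.right_neutral)
  then have "A_norm A (T x) \<le> (SUP x\<in>{x. A_norm A x = 1}. A_norm A (T x))"
    by (rule cSUP_upper2[where x=x]) (use assms(3) in auto)
  then show ?thesis
    using assms(3) by (auto simp: A_opnorm_def)
qed

text \<open>Vectors of nonzero seminorm are rescaled to the unit sphere; on null vectors, where this
  fails, \<open>A\<close>-boundedness makes \<open>T x\<close> null as well.\<close>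

lemma A_norm_le_A_opnorm:
  assumes "positive_op A" "A_bounded A T"
  shows "A_norm A (T x) \<le> A_opnorm A T * A_norm A x"
proof (cases "A_norm A x = 0")
  case True
  obtain c where "A_norm A (T x) \<le> c * A_norm A x"
    using assms(2) unfolding A_bounded_def by blast
  with True show ?thesis by simp
next
  case False
  let ?n = "A_norm A x"
  have pos: "?n > 0" using False A_norm_nonneg[OF assms(1), of x] by simp
  have "A_norm A (T ((1 / ?n) *\<^sub>R x)) \<le> A_opnorm A T"
    by (rule A_opnorm_upper[OF assms]) (use pos in \<open>simp add: A_norm_scaleR[OF assms(1)]\<close>)
  then show ?thesis
    using pos by (simp add: linear_cmul[OF A_bounded_linear[OF assms(2)]]
        A_norm_scaleR[OF assms(1)] field_simps)
qed

text \<open>\<open>0 \<le> C\<close> matters when no vector has unit seminorm and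
  \<open>A_opnorm\<close> takes its default value 0.\<close>

lemma A_opnorm_least:
  assumes "0 \<le> C" "\<And>x. A_norm A (T x) \<le> C * A_norm A x"
  shows "A_opnorm A T \<le> C"
  unfolding A_opnorm_def using assms by (auto intro!: cSUP_least) (metis mult.right_neutral)

text \<open>The bound by \<open>C\<close> makes the real supremum meaningful; its pointwise form
  suits iterates known only through a growth estimate.\<close>

lemma A_opnorm_nonneg:
  assumes "positive_op A" "\<And>x. A_norm A (T x) \<le> C * A_norm A x"
  shows "0 \<le> A_opnorm A T"
proof (cases "{x. A_norm A x = 1} = {}")
  case False
  then obtain x where x: "A_norm A x = 1" by auto
  have "bdd_above ((\<lambda>x. A_norm A (T x)) ` {x. A_norm A x = 1})"
    using assms(2) by (intro bdd_aboveI[of _ C]) (auto, metis mult.right_neutral)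
  then have "0 \<le> (SUP x\<in>{x. A_norm A x = 1}. A_norm A (T x))"
    by (rule cSUP_upper2[where x=x]) (use x in \<open>auto simp: A_norm_nonneg[OF assms(1)]\<close>)
  with False show ?thesis by (simp add: A_opnorm_def)
qed (simp add: A_opnorm_def)

section \<open>Growth estimates and the spectral radius\<close>

lemma A_spectral_radius_le_of_growth:
  assumes A: "positive_op A" and "0 < r" "0 < K"
    and growth: "\<And>n x. 1 \<le> n \<Longrightarrow> A_norm A ((P ^^ n) x) \<le> K * r ^ n * A_norm A x"
  shows "A_spectral_radius A P \<le> r"
proof -
  have nonneg: "0 \<le> A_opnorm A (P ^^ n)" if "1 \<le> n" for n
    using A growth[OF that] by (rule A_opnorm_nonneg)
  have "A_spectral_radius A P \<le> root n K * r" if "1 \<le> n" for n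
  proof -
    have "A_spectral_radius A P \<le> root n (A_opnorm A (P ^^ n))"
      unfolding A_spectral_radius_def
      using that nonneg by (intro cINF_lower bdd_belowI[of _ 0]) auto
    also have "\<dots> \<le> root n (K * r ^ n)"
      using that assms(2,3) growth[OF that]
      by (intro real_root_le_mono A_opnorm_least) auto
    also have "\<dots> = root n K * r"
      using that assms(2) by (simp add: real_root_mult real_root_power_cancel)
    finally show ?thesis .
  qed
  \<comment> \<open>The constant \<open>K\<close> disappears because its \<open>n\<close>-th roots
    tend to 1.\<close>
  moreover have "(\<lambda>n. root n K * r) \<longlonglongrightarrow> 1 * r"
    using assms(3) by (intro tendsto_mult tendsto_const LIMSEQ_root_const)
  ultimately show ?thesis
    using LIMSEQ_le_const[of "\<lambda>n. root n K * r" r] by auto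
qed

text \<open>The bound is the larger eigenvalue of the matrix with rows \<open>(p, s)\<close> and
  \<open>(t, q)\<close>, and \<open>(u, v)\<close> is a left sub-eigenvector for \<open>r\<close>.
  Taking \<open>r\<close> strictly larger allows both weights to be positive even when
  \<open>s\<close> or \<open>t\<close> vanishes.\<close>

lemma Perron_weights:
  fixes p q s t r :: real
  assumes "0 \<le> p" "0 \<le> q" "0 \<le> s" "0 \<le> t"
    and "1 / 2 * (p + q + sqrt ((p - q)\<^sup>2 + 4 * s * t)) < r"
  obtains u v where "0 < r" "0 < u" "0 < v" "u * p + v * t \<le> r * u" "u * s + v * q \<le> r * v"
proof -
  define D where "D = sqrt ((p - q)\<^sup>2 + 4 * s * t)"
  have "\<bar>p - q\<bar> \<le> D"
    unfolding D_def using assms by (intro real_le_rsqrt) auto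
  \<comment> \<open>These are \<lambda> - p and \<lambda> - q for the eigenvalue \<lambda> = (p + q
    + D) / 2; that their product is \<open>t * s\<close> is the characteristic equation.\<close>
  then have le: "0 \<le> (q - p + D) / 2" "0 \<le> (p - q + D) / 2" by auto
  have less: "(q - p + D) / 2 < r - p" "(p - q + D) / 2 < r - q"
    using assms(5) unfolding D_def[symmetric] by argo+
  have "D\<^sup>2 = (p - q)\<^sup>2 + 4 * s * t"
    unfolding D_def using assms by simp
  then have "t * s = (q - p + D) / 2 * ((p - q + D) / 2)"
    by (simp add: power2_eq_square algebra_simps)
  also have "\<dots> < (r - p) * (r - q)"
    using less le by (intro mult_strict_mono') auto
  finally have gap: "t * s < (r - p) * (r - q)" .
  \<comment> \<open>The weights \<open>t\<close>, \<open>r - p\<close> give equality in the first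
    inequality and slack \<open>(r - p) * (r - q) - t * s\<close> in the second. As \<open>t\<close>
    may be 0, it is raised by \<open>d\<close> with \<open>d * s\<close> within that slack; the
    divisor \<open>s + 1\<close> covers \<open>s = 0\<close>.\<close>
  define d where "d = ((r - p) * (r - q) - t * s) / (s + 1)"
  have d: "0 < d" and ds: "d * s \<le> (r - p) * (r - q) - t * s"
    unfolding d_def using gap assms(3) by (auto simp: field_simps)
  have rp: "0 < r - p" using less le by linarith
  show ?thesis
  proof (rule that[of "t + d" "r - p"])
    show "(t + d) * p + (r - p) * t \<le> r * (t + d)"
      using mult_pos_pos[OF d rp] by (simp add: algebra_simps)
    show "(t + d) * s + (r - p) * q \<le> r * (r - p)"
      using ds by (simp add: algebra_simps)
  qed (use d rp assms in auto)
qed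

text \<open>The real factor \<open>\<epsilon>\<close> treats both signs at once; its size enters
  through the triangle inequality.\<close>

lemma A_spectral_radius_TS_plus_scaled_ST:
  fixes A T S :: "'a::complex_inner_space \<Rightarrow> 'a" and \<epsilon> :: real
  assumes A: "positive_op A" and T: "A_bounded A T" and S: "A_bounded A S" and "\<bar>\<epsilon>\<bar> \<le> 1"
  shows "A_spectral_radius A (\<lambda>x. T (S x) + \<epsilon> *\<^sub>R S (T x)) \<le>
    1 / 2 * (A_opnorm A (T \<circ> S) + A_opnorm A (S \<circ> T) +
      sqrt ((A_opnorm A (T \<circ> S) - A_opnorm A (S \<circ> T))\<^sup>2 +
            4 * A_opnorm A (T ^^ 2) * A_opnorm A (S ^^ 2)))"
    (is "A_spectral_radius A ?P \<le> ?R")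
proof (rule dense_ge)
  fix r assume r: "?R < r"
  let ?N = "A_norm A" and ?q = "A_opnorm A (T \<circ> S)" and ?p = "A_opnorm A (S \<circ> T)"
    and ?t = "A_opnorm A (T ^^ 2)" and ?s = "A_opnorm A (S ^^ 2)"
  have sq: "T ^^ 2 = T \<circ> T" "S ^^ 2 = S \<circ> S"
    by (simp_all add: numeral_2_eq_2)
  have bdd: "A_bounded A (T \<circ> S)" "A_bounded A (S \<circ> T)" "A_bounded A (T ^^ 2)"
    "A_bounded A (S ^^ 2)"
    unfolding sq using T S by (auto intro: A_bounded_compose)
  note bound = A_norm_le_A_opnorm[OF A bdd(1), unfolded comp_def]
    A_norm_le_A_opnorm[OF A bdd(2), unfolded comp_def]
    A_norm_le_A_opnorm[OF A bdd(3), unfolded sq comp_def]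
    A_norm_le_A_opnorm[OF A bdd(4), unfolded sq comp_def]
  have nonneg: "0 \<le> A_opnorm A U" if "A_bounded A U" for U
    using A A_norm_le_A_opnorm[OF A that] by (rule A_opnorm_nonneg)
  obtain u v where r0: "0 < r" and uv: "0 < u" "0 < v"
    and u: "u * ?p + v * ?t \<le> r * u" and v: "u * ?s + v * ?q \<le> r * v"
  proof (rule Perron_weights[of ?p ?q ?s ?t r])
    \<comment> \<open>Here \<open>?p\<close> belongs to \<open>S \<circ> T\<close>, the reverse of
      the order in \<open>?R\<close>; the bound is symmetric under this swap.\<close>
    show "1 / 2 * (?p + ?q + sqrt ((?p - ?q)\<^sup>2 + 4 * ?s * ?t)) < r"
      using r by (simp add: power2_commute[of ?p] ac_simps)
  qed (use nonneg bdd in auto)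
  obtain cT where cT: "cT > 0" "\<And>x. ?N (T x) \<le> cT * ?N x"
    using T unfolding A_bounded_def by blast
  obtain cS where cS: "cS > 0" "\<And>x. ?N (S x) \<le> cS * ?N x"
    using S unfolding A_bounded_def by blast
  have N_comb: "?N (x + \<epsilon> *\<^sub>R y) \<le> ?N x + ?N y" for x y
    using A_norm_triangle[OF A, of x "\<epsilon> *\<^sub>R y"] mult_right_mono[OF assms(4) A_norm_nonneg[OF A, of y]]
    by (simp add: A_norm_scaleR[OF A])
  define g where "g x = u * ?N (S x) + v * ?N (T x)" for x
  have g_step: "g (?P x) \<le> r * g x" for x
  proof -
    have "?N (S (?P x)) \<le> ?N (S (T (S x))) + ?N (S (S (T x)))"
      using N_comb by (simp add: linear_add[OF A_bounded_linear[OF S]] linear_cmul[OF A_bounded_linear[OF S]])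
    also have "\<dots> \<le> ?p * ?N (S x) + ?s * ?N (T x)"
      by (intro add_mono) (use bound[of "S x"] bound[of "T x"] in \<open>simp_all add: sq comp_def\<close>)
    finally have 1: "u * ?N (S (?P x)) \<le> u * (?p * ?N (S x) + ?s * ?N (T x))"
      using uv by simp
    have "?N (T (?P x)) \<le> ?N (T (T (S x))) + ?N (T (S (T x)))"
      using N_comb by (simp add: linear_add[OF A_bounded_linear[OF T]] linear_cmul[OF A_bounded_linear[OF T]])
    also have "\<dots> \<le> ?t * ?N (S x) + ?q * ?N (T x)"
      by (intro add_mono) (use bound[of "S x"] bound[of "T x"] in \<open>simp_all add: sq comp_def\<close>)
    finally have 2: "v * ?N (T (?P x)) \<le> v * (?t * ?N (S x) + ?q * ?N (T x))"
      using uv by simp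
    have "g (?P x) \<le> (u * ?p + v * ?t) * ?N (S x) + (u * ?s + v * ?q) * ?N (T x)"
      unfolding g_def using 1 2 by (simp add: algebra_simps)
    also have "\<dots> \<le> r * u * ?N (S x) + r * v * ?N (T x)"
      by (intro add_mono mult_right_mono u v A_norm_nonneg[OF A])
    finally show ?thesis by (simp add: g_def algebra_simps)
  qed
  have g_iter: "g ((?P ^^ n) x) \<le> r ^ n * g x" for n x
  proof (induction n)
    case (Suc n)
    have "g ((?P ^^ Suc n) x) \<le> r * g ((?P ^^ n) x)"
      using g_step by simp
    also have "\<dots> \<le> r * (r ^ n * g x)"
      using Suc r0 by simp
    finally show ?case by simp
  qed simp
  define M where "M = cT / u + cS / v"
  define L where "L = u * cS + v * cT"
  have M: "M > 0" and L: "L > 0"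
    unfolding M_def L_def using uv cT(1) cS(1) by (auto intro!: add_pos_pos)
  have N_g: "?N (?P x) \<le> M * g x" for x
  proof -
    have "?N (?P x) \<le> cT * ?N (S x) + cS * ?N (T x)"
      using N_comb[of "T (S x)" "S (T x)"] cT(2)[of "S x"] cS(2)[of "T x"] by linarith
    \<comment> \<open>The added nonnegative cross terms complete the sum to
      \<open>M * g x\<close>.\<close>
    also have "\<dots> \<le> cT * ?N (S x) + cS * ?N (T x)
        + (cT / u * v * ?N (T x) + cS / v * u * ?N (S x))"
      using uv cT(1) cS(1) A_norm_nonneg[OF A] by simp
    also have "\<dots> = M * g x"
      unfolding M_def g_def using uv by (simp add: field_simps)
    finally show ?thesis .
  qed
  have g_N: "g x \<le> L * ?N x" for x
  proof -
    have "g x \<le> u * (cS * ?N x) + v * (cT * ?N x)"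
      unfolding g_def using uv cT(2) cS(2) by (intro add_mono mult_left_mono) auto
    then show ?thesis by (simp add: L_def algebra_simps)
  qed
  \<comment> \<open>One application of \<open>?P\<close> is spent on passing from the seminorm to
    \<open>g\<close>, which leaves \<open>r ^ (n - 1)\<close>; hence the division by
    \<open>r\<close> and the restriction to \<open>1 \<le> n\<close>.\<close>
  show "A_spectral_radius A ?P \<le> r"
  proof (rule A_spectral_radius_le_of_growth[OF A r0, of "M * L / r"])
    show "0 < M * L / r" using M L r0 by simp
    fix n :: nat and x assume "1 \<le> n"
    then obtain m where n: "n = Suc m" by (cases n) auto
    have "?N ((?P ^^ n) x) \<le> M * g ((?P ^^ m) x)"
      using N_g by (simp add: n)
    also have "\<dots> \<le> M * (r ^ m * (L * ?N x))"
      using M r0 g_N[of x] order_trans[OF g_iter[of m x] mult_left_mono[OF g_N[of x]]] by simp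
    also have "\<dots> = M * L / r * r ^ n * ?N x"
      using r0 by (simp add: n field_simps)
    finally show "?N ((?P ^^ n) x) \<le> M * L / r * r ^ n * ?N x" .
  qed
qed

theorem corollary2p1:
  fixes A T S :: "'a::complex_hilbert_space \<Rightarrow> 'a"
  assumes "positive_op A"
    and "A_bounded A T" and "A_bounded A S"
  shows "A_spectral_radius A (\<lambda>x. T (S x) + S (T x)) \<le>
      1 / 2 * (A_opnorm A (T \<circ> S) + A_opnorm A (S \<circ> T) +
        sqrt ((A_opnorm A (T \<circ> S) - A_opnorm A (S \<circ> T))\<^sup>2 +
              4 * A_opnorm A (T ^^ 2) * A_opnorm A (S ^^ 2))) \<and>
    A_spectral_radius A (\<lambda>x. T (S x) - S (T x)) \<le>
      1 / 2 * (A_opnorm A (T \<circ> S) + A_opnorm A (S \<circ> T) +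
        sqrt ((A_opnorm A (T \<circ> S) - A_opnorm A (S \<circ> T))\<^sup>2 +
              4 * A_opnorm A (T ^^ 2) * A_opnorm A (S ^^ 2)))"
  using A_spectral_radius_TS_plus_scaled_ST[OF assms, of 1]
    A_spectral_radius_TS_plus_scaled_ST[OF assms, of "-1"] by simp

end
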